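(* Let $\mathrm{CB}$ be the category whose objects are a finite set of bases of $V=\mathrm{span}\{x^m,x^{m+1},\ldots,x^n\}$, $0\le m\le n$, with exactly one morphism $M_{vt}:v\to t$ (the change of basis matrix) for each ordered pair of objects and with composition given by matrix product. Then $\mathrm{CB}$ has the following full subcategories: - $\mathrm{UTr}$, whose objects are the descending bases and whose morphisms are upper-triangular matrices; - $\mathrm{LTr}$, whose objects are the ascending bases and whose morphisms are lower-triangular matrices; - $\mathrm{Alt}$, whose objects are the alternating bases and whose morphisms are alternating matrices; - $\mathrm{UAlt}$, whose objects are the descending alternating bases and whose morphisms are upper-triangular alternating matrices; - $\mathrm{LAlt}$, whose objects are the ascending alternating bases and whose morphisms are lower-triangular alternating matrices. Moreover $\mathrm{UTr}$, $\mathrm{Alt}$ and $\mathrm{LTr}$ are subcategories of $\mathrm{CB}$; $\mathrm{UAlt}$ is a subcategory of both $\mathrm{UTr}$ and $\mathrm{Alt}$; and $\mathrm{LAlt}$ is a subcategory of both $\mathrm{LTr}$ and $\mathrm{Alt}$.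
   Context: For ordered bases $v,t$ of $V$, $M_{vt}$ is the matrix whose $j$-th column is the coordinate vector with respect to $v$ of the $j$-th element of $t$; composition is $M_{vr}\circ M_{rt}=M_{vr}M_{rt}=M_{vt}$ for $M_{vr}:v\to r$, $M_{rt}:r\to t$. A descending basis is a basis $(p_0,\ldots,p_{n-m})$ of $V$ with $\deg p_j=m+j$. An ascending basis is a basis $(p_0,\ldots,p_{n-m})$ of $V$ where $p_j$ has minimum degree (least exponent with nonzero coefficient) $m+j$. A descending (ascending) basis is alternating if each $p_j$ contains only monomials $x^e$ with $e\equiv m+j\pmod2$. An alternating basis is a descending or ascending alternating basis. A matrix $(a_{i,j})$ with $0\le i,j\le n-m$ is called alternating if $a_{i,j}=0$ whenever $i-j$ is odd. *)

theory Defs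
  imports
    "Jordan_Normal_Form.Matrix"
    "HOL-Computational_Algebra.Polynomial"
    "HOL-Number_Theory.Cong"
begin

section \<open>Categories and subcategories\<close>

text \<open>
  Arrows are given by a family of hom-sets, and composition is indexed by the three objects
  involved, so the same value may serve as an arrow in several hom-sets. Composition is written
  in diagrammatic order: \<open>Comp C X Y Z f g\<close> is the composite of \<open>f : X \<rightarrow> Y\<close> and \<open>g : Y \<rightarrow> Z\<close>.
\<close>

record ('o, 'a) cat =
  Obj :: "'o set"
  Hom :: "'o \<Rightarrow> 'o \<Rightarrow> 'a set"
  Ident :: "'o \<Rightarrow> 'a"
  Comp :: "'o \<Rightarrow> 'o \<Rightarrow> 'o \<Rightarrow> 'a \<Rightarrow> 'a \<Rightarrow> 'a"

definition category :: "('o, 'a) cat \<Rightarrow> bool" where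
  "category C \<longleftrightarrow>
     (\<forall>X\<in>Obj C. Ident C X \<in> Hom C X X) \<and>
     (\<forall>X\<in>Obj C. \<forall>Y\<in>Obj C. \<forall>Z\<in>Obj C. \<forall>f\<in>Hom C X Y. \<forall>g\<in>Hom C Y Z.
        Comp C X Y Z f g \<in> Hom C X Z) \<and>
     (\<forall>X\<in>Obj C. \<forall>Y\<in>Obj C. \<forall>f\<in>Hom C X Y.
        Comp C X X Y (Ident C X) f = f \<and> Comp C X Y Y f (Ident C Y) = f) \<and>
     (\<forall>W\<in>Obj C. \<forall>X\<in>Obj C. \<forall>Y\<in>Obj C. \<forall>Z\<in>Obj C.
        \<forall>f\<in>Hom C W X. \<forall>g\<in>Hom C X Y. \<forall>h\<in>Hom C Y Z.
        Comp C W Y Z (Comp C W X Y f g) h = Comp C W X Z f (Comp C X Y Z g h))"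

definition subcategory :: "('o, 'a) cat \<Rightarrow> ('o, 'a) cat \<Rightarrow> bool" where
  "subcategory S C \<longleftrightarrow>
     category S \<and> category C \<and>
     Obj S \<subseteq> Obj C \<and>
     (\<forall>X\<in>Obj S. \<forall>Y\<in>Obj S. Hom S X Y \<subseteq> Hom C X Y) \<and>
     (\<forall>X\<in>Obj S. Ident S X = Ident C X) \<and>
     (\<forall>X\<in>Obj S. \<forall>Y\<in>Obj S. \<forall>Z\<in>Obj S. \<forall>f\<in>Hom S X Y. \<forall>g\<in>Hom S Y Z.
        Comp S X Y Z f g = Comp C X Y Z f g)"

definition full_subcategory :: "('o, 'a) cat \<Rightarrow> ('o, 'a) cat \<Rightarrow> bool" where
  "full_subcategory S C \<longleftrightarrow>
     subcategory S C \<and> (\<forall>X\<in>Obj S. \<forall>Y\<in>Obj S. Hom S X Y = Hom C X Y)"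

text \<open>
  Keep only the objects satisfying \<open>P\<close> and the arrows satisfying \<open>Q\<close>. The result need not be
  a category, and when it is a subcategory it need not be full.
\<close>

definition restrict_cat :: "('o, 'a) cat \<Rightarrow> ('o \<Rightarrow> bool) \<Rightarrow> ('a \<Rightarrow> bool) \<Rightarrow> ('o, 'a) cat" where
  "restrict_cat C P Q =
     \<lparr>Obj = {X \<in> Obj C. P X}, Hom = (\<lambda>X Y. {f \<in> Hom C X Y. Q f}),
      Ident = Ident C, Comp = Comp C\<rparr>"


section \<open>Ordered bases of spaces of polynomials\<close>

interpretation poly_vs: vector_space "smult :: 'k::field \<Rightarrow> 'k poly \<Rightarrow> 'k poly"
  by unfold_locales (simp_all add: smult_add_right smult_add_left)

definition poly_space :: "nat \<Rightarrow> nat \<Rightarrow> 'k::field poly set" where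
  "poly_space m n = poly_vs.span {monom 1 e | e. m \<le> e \<and> e \<le> n}"

definition poly_basis :: "nat \<Rightarrow> nat \<Rightarrow> 'k::field poly list \<Rightarrow> bool" where
  "poly_basis m n p \<longleftrightarrow>
     length p = n - m + 1 \<and> distinct p \<and>
     poly_vs.independent (set p) \<and> poly_vs.span (set p) = poly_space m n"

text \<open>Only meaningful for nonzero polynomials.\<close>

definition min_degree :: "'k::zero poly \<Rightarrow> nat" where
  "min_degree p = (LEAST e. coeff p e \<noteq> 0)"

definition descending_basis :: "nat \<Rightarrow> nat \<Rightarrow> 'k::field poly list \<Rightarrow> bool" where
  "descending_basis m n p \<longleftrightarrow>
     poly_basis m n p \<and> (\<forall>j\<le>n - m. degree (p ! j) = m + j)"

definition ascending_basis :: "nat \<Rightarrow> nat \<Rightarrow> 'k::field poly list \<Rightarrow> bool" where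
  "ascending_basis m n p \<longleftrightarrow>
     poly_basis m n p \<and> (\<forall>j\<le>n - m. min_degree (p ! j) = m + j)"

definition parity_graded :: "nat \<Rightarrow> nat \<Rightarrow> 'k::zero poly list \<Rightarrow> bool" where
  "parity_graded m n p \<longleftrightarrow>
     (\<forall>j\<le>n - m. \<forall>e. coeff (p ! j) e \<noteq> 0 \<longrightarrow> [e = m + j] (mod 2))"

definition descending_alternating_basis :: "nat \<Rightarrow> nat \<Rightarrow> 'k::field poly list \<Rightarrow> bool" where
  "descending_alternating_basis m n p \<longleftrightarrow> descending_basis m n p \<and> parity_graded m n p"

definition ascending_alternating_basis :: "nat \<Rightarrow> nat \<Rightarrow> 'k::field poly list \<Rightarrow> bool" where
  "ascending_alternating_basis m n p \<longleftrightarrow> ascending_basis m n p \<and> parity_graded m n p"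

definition alternating_basis :: "nat \<Rightarrow> nat \<Rightarrow> 'k::field poly list \<Rightarrow> bool" where
  "alternating_basis m n p \<longleftrightarrow>
     descending_alternating_basis m n p \<or> ascending_alternating_basis m n p"


section \<open>Change of basis matrices\<close>

definition change_of_basis :: "'k::field poly list \<Rightarrow> 'k poly list \<Rightarrow> 'k mat" where
  "change_of_basis v t =
     mat (length v) (length t) (\<lambda>(i, j). poly_vs.representation (set v) (t ! j) (v ! i))"

definition lower_triangular :: "'a::zero mat \<Rightarrow> bool" where
  "lower_triangular A \<longleftrightarrow> (\<forall>i<dim_row A. \<forall>j<dim_col A. i < j \<longrightarrow> A $$ (i, j) = 0)"

definition alternating_mat :: "'a::zero mat \<Rightarrow> bool" where
  "alternating_mat A \<longleftrightarrow>
     (\<forall>i<dim_row A. \<forall>j<dim_col A. odd (int i - int j) \<longrightarrow> A $$ (i, j) = 0)"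


section \<open>The category of bases and its subcategories\<close>

definition CB :: "'k::field poly list set \<Rightarrow> ('k poly list, 'k mat) cat" where
  "CB B =
     \<lparr>Obj = B, Hom = (\<lambda>v t. {change_of_basis v t}),
      Ident = (\<lambda>v. change_of_basis v v), Comp = (\<lambda>v r t M N. M * N)\<rparr>"

definition UTr :: "nat \<Rightarrow> nat \<Rightarrow> 'k::field poly list set \<Rightarrow> ('k poly list, 'k mat) cat" where
  "UTr m n B = restrict_cat (CB B) (descending_basis m n) upper_triangular"

definition LTr :: "nat \<Rightarrow> nat \<Rightarrow> 'k::field poly list set \<Rightarrow> ('k poly list, 'k mat) cat" where
  "LTr m n B = restrict_cat (CB B) (ascending_basis m n) lower_triangular"

definition Alt :: "nat \<Rightarrow> nat \<Rightarrow> 'k::field poly list set \<Rightarrow> ('k poly list, 'k mat) cat" where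
  "Alt m n B = restrict_cat (CB B) (alternating_basis m n) alternating_mat"

definition UAlt :: "nat \<Rightarrow> nat \<Rightarrow> 'k::field poly list set \<Rightarrow> ('k poly list, 'k mat) cat" where
  "UAlt m n B =
     restrict_cat (CB B) (descending_alternating_basis m n)
       (\<lambda>M. upper_triangular M \<and> alternating_mat M)"

definition LAlt :: "nat \<Rightarrow> nat \<Rightarrow> 'k::field poly list set \<Rightarrow> ('k poly list, 'k mat) cat" where
  "LAlt m n B =
     restrict_cat (CB B) (ascending_alternating_basis m n)
       (\<lambda>M. lower_triangular M \<and> alternating_mat M)"

end

theory Submission
  imports Defs
begin

text \<open>
  Column \<open>j\<close> of the change of basis matrix from \<open>v\<close> to \<open>t\<close> expands \<open>t ! j\<close> in \<open>v\<close>. Substituting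
  one expansion into another, and comparing with the third by uniqueness of coordinates, gives
  \<open>M\<^sub>v\<^sub>r M\<^sub>r\<^sub>t = M\<^sub>v\<^sub>t\<close> and \<open>M\<^sub>v\<^sub>v = 1\<close> (\<open>change_of_basis_mult\<close>, \<open>change_of_basis_self\<close>). So
  the composite of two arrows is again the arrow between the outer bases, and the category laws
  hold because both sides of each law lie in the same one-element hom-set.

  Since each hom-set is a singleton, a subcategory obtained by restricting the objects and
  requiring a shape of the matrices is full exactly when the matrices between the remaining
  bases automatically have that shape. Thus the content of the theorem is the three shapes:

  \<^item> Triangularity: comparing the coefficients of \<open>t ! j = (\<Sum>i. M\<^sub>i\<^sub>j v ! i)\<close> at the exponents
    \<open>m + i\<close> gives a linear system for column \<open>j\<close> of \<open>M\<close>. For descending bases the coefficient of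
    \<open>v ! k\<close> at \<open>m + i\<close> vanishes for \<open>k < i\<close> and not for \<open>k = i\<close>, so the system is solved
    by back substitution, starting from the top exponent; its right-hand side vanishes at the
    exponents above \<open>m + j\<close>, and so does its solution. Ascending bases are the mirror image, with
    forward substitution (\<open>substitution_zero\<close> covers both).

  \<^item> Alternation: split the expansion of \<open>t ! j\<close> according to the parity of \<open>i - j\<close>. The two
    halves involve monomials of opposite parity, and \<open>t ! j\<close> has the parity of the first half, so
    the first half alone already equals \<open>t ! j\<close>; uniqueness of coordinates annihilates the
    coefficients in the second half. The argument sees only parities, so it also applies between
    a descending and an ascending basis, both of which occur among the objects of \<open>Alt\<close>.
\<close>

section \<open>Restricting a category\<close>

text \<open>
  If \<open>Q\<close> holds for every arrow between the retained objects, then the restriction discards no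
  arrow between them, so identities and composites stay inside.
\<close>

lemma full_subcategory_restrict_cat:
  assumes C: "category C"
    and Q: "\<And>X Y f. \<lbrakk>X \<in> Obj C; Y \<in> Obj C; P X; P Y; f \<in> Hom C X Y\<rbrakk> \<Longrightarrow> Q f"
  shows "full_subcategory (restrict_cat C P Q) C"
proof -
  have hom: "{f \<in> Hom C X Y. Q f} = Hom C X Y"
    if "X \<in> Obj C" "Y \<in> Obj C" "P X" "P Y" for X Y
    using Q that by blast
  have "category (restrict_cat C P Q)"
    using C unfolding category_def by (simp add: restrict_cat_def hom)
  with C show ?thesis
    unfolding full_subcategory_def subcategory_def
    by (auto simp: restrict_cat_def hom)
qed

lemma subcategory_restrict_cat_mono:
  assumes "category (restrict_cat C P Q)" "category (restrict_cat C P' Q')"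
    and "\<And>X. P X \<Longrightarrow> P' X" "\<And>f. Q f \<Longrightarrow> Q' f"
  shows "subcategory (restrict_cat C P Q) (restrict_cat C P' Q')"
  using assms unfolding subcategory_def by (auto simp: restrict_cat_def)


section \<open>Coordinates with respect to a basis\<close>

lemma poly_basis_nth_in_space:
  assumes "poly_basis m n t" "j < length t"
  shows "t ! j \<in> poly_space m n"
  using assms poly_vs.span_base[of "t ! j" "set t"] by (auto simp: poly_basis_def)

text \<open>
  Uniqueness of coordinates, indexed by positions in the list: distinctness of the entries of \<open>v\<close>
  keeps two coefficients from being added up on the same basis vector.
\<close>

lemma representation_sum_nth:
  fixes v :: "'k::field poly list"
  assumes v: "poly_basis m n v" and k: "k < length v"
  shows "poly_vs.representation (set v) (\<Sum>i<length v. smult (a i) (v ! i)) (v ! k) = a k"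
proof -
  have ind: "poly_vs.independent (set v)" and dist: "distinct v"
    using v by (auto simp: poly_basis_def)
  have mem: "v ! i \<in> poly_vs.span (set v)" if "i < length v" for i
    using that by (intro poly_vs.span_base nth_mem)
  have "poly_vs.representation (set v) (\<Sum>i<length v. smult (a i) (v ! i)) (v ! k)
      = (\<Sum>i<length v. poly_vs.representation (set v) (smult (a i) (v ! i)) (v ! k))"
    using mem by (subst poly_vs.representation_sum[OF ind]) (auto intro: poly_vs.span_scale)
  also have "\<dots> = (\<Sum>i<length v. if i = k then a i else 0)"
    using mem k dist
    by (intro sum.cong refl)
       (auto simp: poly_vs.representation_scale[OF ind] poly_vs.representation_basis[OF ind]
         nth_eq_iff_index_eq)
  finally show ?thesis using k by simp
qed

lemma change_of_basis_expansion:
  assumes v: "poly_basis m n v" and t: "poly_basis m n t" and j: "j < length t"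
  shows "t ! j = (\<Sum>i<length v. smult (change_of_basis v t $$ (i, j)) (v ! i))"
proof -
  let ?R = "poly_vs.representation (set v) (t ! j)"
  have "t ! j \<in> poly_vs.span (set v)"
    using poly_basis_nth_in_space[OF t j] v by (simp add: poly_basis_def)
  then have "t ! j = (\<Sum>b\<in>set v. smult (?R b) b)"
    using v by (intro poly_vs.sum_representation_eq[symmetric]) (auto simp: poly_basis_def)
  also have "\<dots> = (\<Sum>i<length v. smult (?R (v ! i)) (v ! i))"
    using v by (intro sum.reindex_bij_betw[symmetric] bij_betw_nth) (auto simp: poly_basis_def)
  finally show ?thesis
    using j by (simp add: change_of_basis_def)
qed

lemma change_of_basis_eqI:
  assumes v: "poly_basis m n v" and "i < length v" "j < length t"
    and "t ! j = (\<Sum>i<length v. smult (a i) (v ! i))"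
  shows "change_of_basis v t $$ (i, j) = a i"
  using assms representation_sum_nth[OF v] by (simp add: change_of_basis_def)

lemma change_of_basis_carrier:
  assumes "poly_basis m n v" "poly_basis m n t"
  shows "change_of_basis v t \<in> carrier_mat (n - m + 1) (n - m + 1)"
  using assms by (simp add: change_of_basis_def poly_basis_def)

lemma change_of_basis_self:
  assumes v: "poly_basis m n v"
  shows "change_of_basis v v = 1\<^sub>m (n - m + 1)"
proof (rule eq_matI)
  have len: "length v = n - m + 1" using v by (simp add: poly_basis_def)
  fix i j assume "i < dim_row (1\<^sub>m (n - m + 1))" "j < dim_col (1\<^sub>m (n - m + 1))"
  then have ij: "i < length v" "j < length v" by (auto simp: len)
  have "v ! j = (\<Sum>i<length v. smult (if i = j then 1 else 0) (v ! i))"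
    using ij by (simp add: if_distrib[of "\<lambda>c. smult c _"] cong: if_cong)
  from change_of_basis_eqI[OF v ij this]
  show "change_of_basis v v $$ (i, j) = 1\<^sub>m (n - m + 1) $$ (i, j)"
    using ij by (simp add: len)
qed (use change_of_basis_carrier[OF v v] in auto)

lemma change_of_basis_mult:
  assumes v: "poly_basis m n v" and r: "poly_basis m n r" and t: "poly_basis m n t"
  shows "change_of_basis v r * change_of_basis r t = change_of_basis v t"
proof (rule eq_matI)
  let ?A = "change_of_basis v r" and ?B = "change_of_basis r t"
  have len: "length v = n - m + 1" "length r = n - m + 1" "length t = n - m + 1"
    using v r t by (simp_all add: poly_basis_def)
  note dims = change_of_basis_carrier[OF v r] change_of_basis_carrier[OF r t]
    change_of_basis_carrier[OF v t]
  fix i j assume "i < dim_row (change_of_basis v t)" "j < dim_col (change_of_basis v t)"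
  then have ij: "i < length v" "j < length t"
    using dims by (auto simp: len)
  have "t ! j = (\<Sum>k<length r. smult (?B $$ (k, j)) (r ! k))"
    by (rule change_of_basis_expansion[OF r t ij(2)])
  also have "\<dots> = (\<Sum>k<length r. smult (?B $$ (k, j)) (\<Sum>i<length v. smult (?A $$ (i, k)) (v ! i)))"
    by (intro sum.cong refl arg_cong[where f = "smult _"] change_of_basis_expansion[OF v r]) simp
  also have "\<dots> = (\<Sum>i<length v. smult (\<Sum>k<length r. ?A $$ (i, k) * ?B $$ (k, j)) (v ! i))"
    unfolding poly_vs.scale_sum_right poly_vs.scale_sum_left
    by (subst sum.swap) (simp add: mult.commute)
  finally have "change_of_basis v t $$ (i, j) = (\<Sum>k<length r. ?A $$ (i, k) * ?B $$ (k, j))"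
    by (rule change_of_basis_eqI[OF v ij])
  then show "(?A * ?B) $$ (i, j) = change_of_basis v t $$ (i, j)"
    using ij dims by (simp add: scalar_prod_def len lessThan_atLeast0)
qed (use change_of_basis_carrier[OF v r] change_of_basis_carrier[OF r t]
      change_of_basis_carrier[OF v t] in auto)

lemma category_CB:
  fixes B :: "'k::field poly list set"
  assumes "\<And>v. v \<in> B \<Longrightarrow> poly_basis m n v"
  shows "category (CB B)"
proof -
  have mult: "change_of_basis v r * change_of_basis r t = change_of_basis v t"
    if "v \<in> B" "r \<in> B" "t \<in> B" for v r t
    using change_of_basis_mult that assms by blast
  show ?thesis
    unfolding category_def by (simp add: CB_def mult)
qed


section \<open>Shapes of change of basis matrices\<close>

text \<open>
  A triangular homogeneous system has only the zero solution. The injective rank \<open>f\<close> is the order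
  in which the unknowns are eliminated, and \<open>N\<close> cuts off the equations: the equation with index
  \<open>i\<close> expresses \<open>a i\<close> through unknowns of smaller rank, which vanish by induction.
\<close>

lemma substitution_zero:
  fixes a :: "nat \<Rightarrow> 'k::idom" and f :: "nat \<Rightarrow> nat"
  assumes f: "inj_on f {..<L}"
    and system: "\<And>i. i < L \<Longrightarrow> f i < N \<Longrightarrow> (\<Sum>k<L. a k * c k i) = 0"
    and tri: "\<And>i k. i < L \<Longrightarrow> k < L \<Longrightarrow> f i < f k \<Longrightarrow> c k i = 0"
    and diag: "\<And>i. i < L \<Longrightarrow> c i i \<noteq> 0"
    and i: "i < L" "f i < N"
  shows "a i = 0"
  using i
proof (induction i rule: measure_induct_rule[of f])
  case (less i)
  have "a k * c k i = 0" if "k < L" "k \<noteq> i" for k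
  proof (cases "f k < f i")
    case True
    then show ?thesis using less that by simp
  next
    case False
    with f that less.prems have "f i < f k"
      by (metis inj_onD lessThan_iff linorder_neqE_nat)
    then show ?thesis using tri that less.prems by simp
  qed
  then have "(\<Sum>k<L. a k * c k i) = (\<Sum>k\<in>{i}. a k * c k i)"
    using less.prems by (intro sum.mono_neutral_right) auto
  then show ?case using system diag less.prems by simp
qed

lemma poly_basis_nth_nonzero:
  assumes "poly_basis m n v" "i < length v"
  shows "v ! i \<noteq> 0"
  using assms poly_vs.dependent_zero[of "set v"] by (metis nth_mem poly_basis_def)

lemma coeff_change_of_basis:
  assumes "poly_basis m n v" "poly_basis m n t" "j < length t"
  shows "coeff (t ! j) e = (\<Sum>i<length v. change_of_basis v t $$ (i, j) * coeff (v ! i) e)"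
  by (subst change_of_basis_expansion[OF assms]) (simp add: coeff_sum)

lemma upper_triangular_change_of_basis:
  fixes v t :: "'k::field poly list"
  assumes v: "descending_basis m n v" and t: "descending_basis m n t"
  shows "upper_triangular (change_of_basis v t)"
proof (rule upper_triangularI)
  fix i j assume ji: "j < i" and "i < dim_row (change_of_basis v t)"
  define L where "L = n - m + 1"
  have bv: "poly_basis m n v" and bt: "poly_basis m n t"
    using v t by (auto simp: descending_basis_def)
  have len: "length v = L" "length t = L"
    using bv bt by (auto simp: poly_basis_def L_def)
  with \<open>i < dim_row _\<close> ji have ij: "i < L" "j < L"
    by (auto simp: change_of_basis_def)
  have deg: "degree (v ! k) = m + k" "degree (t ! k) = m + k" if "k < L" for k
    using v t that by (auto simp: descending_basis_def L_def)
  show "change_of_basis v t $$ (i, j) = 0"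
  \<comment> \<open>Back substitution: the rank reverses the indices, and the right-hand sides
    vanish at the ranks below that of \<open>j\<close>.\<close>
  proof (rule substitution_zero[where a = "\<lambda>i. change_of_basis v t $$ (i, j)" and L = L
        and f = "\<lambda>i. L - i" and N = "L - j" and c = "\<lambda>k i. coeff (v ! k) (m + i)"])
    show "inj_on ((-) L) {..<L}" by (auto simp: inj_on_def)
  next
    fix i assume "i < L" "L - i < L - j"
    then have "coeff (t ! j) (m + i) = 0"
      using deg ij by (intro coeff_eq_0) auto
    then show "(\<Sum>k<L. change_of_basis v t $$ (k, j) * coeff (v ! k) (m + i)) = 0"
      using coeff_change_of_basis[OF bv bt] ij by (simp add: len)
  next
    fix i k assume "i < L" "k < L" "L - i < L - k"
    then show "coeff (v ! k) (m + i) = 0"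
      using deg by (intro coeff_eq_0) auto
  next
    fix i assume "i < L"
    then show "coeff (v ! i) (m + i) \<noteq> 0"
      using deg poly_basis_nth_nonzero[OF bv] leading_coeff_neq_0[of "v ! i"] by (simp add: len)
  qed (use ij ji in auto)
qed

lemma coeff_min_degree_nonzero:
  assumes "p \<noteq> 0"
  shows "coeff p (min_degree p) \<noteq> 0"
  unfolding min_degree_def by (rule LeastI_ex) (use assms in \<open>auto simp: poly_eq_iff\<close>)

lemma coeff_less_min_degree: "e < min_degree p \<Longrightarrow> coeff p e = 0"
  unfolding min_degree_def by (auto dest: not_less_Least)

lemma lower_triangular_change_of_basis:
  fixes v t :: "'k::field poly list"
  assumes v: "ascending_basis m n v" and t: "ascending_basis m n t"
  shows "lower_triangular (change_of_basis v t)"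
  unfolding lower_triangular_def
proof (intro allI impI)
  fix i j
  assume "i < dim_row (change_of_basis v t)" "j < dim_col (change_of_basis v t)" and less: "i < j"
  define L where "L = n - m + 1"
  have bv: "poly_basis m n v" and bt: "poly_basis m n t"
    using v t by (auto simp: ascending_basis_def)
  have len: "length v = L" "length t = L"
    using bv bt by (auto simp: poly_basis_def L_def)
  with \<open>i < dim_row _\<close> \<open>j < dim_col _\<close> have ij: "i < L" "j < L"
    by (auto simp: change_of_basis_def)
  have deg: "min_degree (v ! k) = m + k" "min_degree (t ! k) = m + k" if "k < L" for k
    using v t that by (auto simp: ascending_basis_def L_def)
  show "change_of_basis v t $$ (i, j) = 0"
  proof (rule substitution_zero[where a = "\<lambda>i. change_of_basis v t $$ (i, j)" and L = L
        and f = "\<lambda>i. i" and N = j and c = "\<lambda>k i. coeff (v ! k) (m + i)"])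
    fix i assume "i < L" "i < j"
    then have "coeff (t ! j) (m + i) = 0"
      using deg ij by (intro coeff_less_min_degree) auto
    then show "(\<Sum>k<L. change_of_basis v t $$ (k, j) * coeff (v ! k) (m + i)) = 0"
      using coeff_change_of_basis[OF bv bt] ij by (simp add: len)
  next
    fix i k assume "i < L" "k < L" "i < k"
    then show "coeff (v ! k) (m + i) = 0"
      using deg by (intro coeff_less_min_degree) auto
  next
    fix i assume "i < L"
    then show "coeff (v ! i) (m + i) \<noteq> 0"
      using deg poly_basis_nth_nonzero[OF bv] coeff_min_degree_nonzero[of "v ! i"]
      by (simp add: len)
  qed (use ij less in auto)
qed

lemma parity_graded_coeff:
  assumes "parity_graded m n p" "j \<le> n - m" "odd (e + (m + j))"
  shows "coeff (p ! j) e = 0"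
  using assms cong_dvd_iff[of e "m + j" 2] unfolding parity_graded_def by auto

text \<open>
  Dropping the coefficients with \<open>i - j\<close> odd leaves a second expansion of \<open>t ! j\<close>: at exponents of
  the parity of \<open>m + j\<close> the dropped terms contribute nothing, and at the other exponents both
  \<open>t ! j\<close> and all the retained terms vanish. By uniqueness the two expansions agree, so the
  dropped coefficients were zero.
\<close>

lemma alternating_change_of_basis:
  fixes v t :: "'k::field poly list"
  assumes v: "poly_basis m n v" "parity_graded m n v"
    and t: "poly_basis m n t" "parity_graded m n t"
  shows "alternating_mat (change_of_basis v t)"
  unfolding alternating_mat_def
proof (intro allI impI)
  let ?M = "change_of_basis v t"
  fix i j
  assume "i < dim_row ?M" "j < dim_col ?M" and odd: "odd (int i - int j)"
  then have ij: "i < length v" "j < length t" by (auto simp: change_of_basis_def)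
  have len: "length v = n - m + 1" "length t = n - m + 1"
    using v(1) t(1) by (auto simp: poly_basis_def)
  let ?a = "\<lambda>i. if even (i + j) then ?M $$ (i, j) else 0"
  have "t ! j = (\<Sum>i<length v. smult (?a i) (v ! i))"
  proof (rule poly_eqI)
    fix e
    show "coeff (t ! j) e = coeff (\<Sum>i<length v. smult (?a i) (v ! i)) e"
    proof (cases "even (e + (m + j))")
      case True
      have "?M $$ (i, j) * coeff (v ! i) e = ?a i * coeff (v ! i) e" if "i < length v" for i
      proof (cases "even (i + j)")
        case False
        with True have "odd (e + (m + i))" by presburger
        then have "coeff (v ! i) e = 0"
          using that by (intro parity_graded_coeff[OF v(2)]) (auto simp: len)
        then show ?thesis by simp
      qed simp
      then show ?thesis
        unfolding coeff_change_of_basis[OF v(1) t(1) ij(2)] coeff_sum coeff_smult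
        by (intro sum.cong) auto
    next
      case False
      have "?a i * coeff (v ! i) e = 0" if "i < length v" for i
      proof (cases "even (i + j)")
        case True
        with False have "odd (e + (m + i))" by presburger
        then have "coeff (v ! i) e = 0"
          using that by (intro parity_graded_coeff[OF v(2)]) (auto simp: len)
        then show ?thesis by simp
      qed simp
      moreover have "coeff (t ! j) e = 0"
        using False ij by (intro parity_graded_coeff[OF t(2)]) (auto simp: len)
      ultimately show ?thesis
        unfolding coeff_sum coeff_smult by (subst sum.neutral) auto
    qed
  qed
  from change_of_basis_eqI[OF v(1) ij this]
  show "?M $$ (i, j) = 0"
    using odd by simp
qed


section \<open>The subcategories\<close>

theorem lemma10:
  fixes m n :: nat and B :: "'k::field poly list set"
  assumes "m \<le> n"
    and "finite B"
    and "\<And>v. v \<in> B \<Longrightarrow> poly_basis m n v"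
  shows "category (CB B) \<and>
    full_subcategory (UTr m n B) (CB B) \<and>
    full_subcategory (LTr m n B) (CB B) \<and>
    full_subcategory (Alt m n B) (CB B) \<and>
    full_subcategory (UAlt m n B) (CB B) \<and>
    full_subcategory (LAlt m n B) (CB B) \<and>
    subcategory (UTr m n B) (CB B) \<and>
    subcategory (Alt m n B) (CB B) \<and>
    subcategory (LTr m n B) (CB B) \<and>
    subcategory (UAlt m n B) (UTr m n B) \<and>
    subcategory (UAlt m n B) (Alt m n B) \<and>
    subcategory (LAlt m n B) (LTr m n B) \<and>
    subcategory (LAlt m n B) (Alt m n B)"
proof -
  have CB: "category (CB B)"
    using assms(3) by (rule category_CB)
  have hom: "f = change_of_basis v t" if "f \<in> Hom (CB B) v t" for f v t
    using that by (simp add: CB_def)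
  have parity: "poly_basis m n v \<and> parity_graded m n v" if "alternating_basis m n v"
    for v :: "'k poly list"
    using that by (auto simp: alternating_basis_def descending_alternating_basis_def
        ascending_alternating_basis_def descending_basis_def ascending_basis_def)
  have alt: "alternating_mat (change_of_basis v t)"
    if "alternating_basis m n v" "alternating_basis m n t" for v t :: "'k poly list"
    using parity that alternating_change_of_basis by blast
  have UTr: "full_subcategory (UTr m n B) (CB B)"
    unfolding UTr_def
    by (rule full_subcategory_restrict_cat[OF CB])
       (auto dest!: hom intro: upper_triangular_change_of_basis)
  have LTr: "full_subcategory (LTr m n B) (CB B)"
    unfolding LTr_def
    by (rule full_subcategory_restrict_cat[OF CB])
       (auto dest!: hom intro: lower_triangular_change_of_basis)
  have Alt: "full_subcategory (Alt m n B) (CB B)"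
    unfolding Alt_def
    by (rule full_subcategory_restrict_cat[OF CB])
       (auto dest!: hom intro: alt)
  have UAlt: "full_subcategory (UAlt m n B) (CB B)"
    unfolding UAlt_def
  proof (rule full_subcategory_restrict_cat[OF CB])
    fix v t f
    assume *: "descending_alternating_basis m n v" "descending_alternating_basis m n t"
      and f: "f \<in> Hom (CB B) v t"
    then show "upper_triangular f \<and> alternating_mat f"
      unfolding hom[OF f]
      by (intro conjI alt upper_triangular_change_of_basis)
         (auto simp: alternating_basis_def descending_alternating_basis_def)
  qed
  have LAlt: "full_subcategory (LAlt m n B) (CB B)"
    unfolding LAlt_def
  proof (rule full_subcategory_restrict_cat[OF CB])
    fix v t f
    assume *: "ascending_alternating_basis m n v" "ascending_alternating_basis m n t"
      and f: "f \<in> Hom (CB B) v t"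
    then show "lower_triangular f \<and> alternating_mat f"
      unfolding hom[OF f]
      by (intro conjI alt lower_triangular_change_of_basis)
         (auto simp: alternating_basis_def ascending_alternating_basis_def)
  qed
  note cats = UTr LTr Alt UAlt LAlt
  note cats = cats[unfolded full_subcategory_def subcategory_def]
  have "subcategory (UAlt m n B) (UTr m n B)" "subcategory (UAlt m n B) (Alt m n B)"
    "subcategory (LAlt m n B) (LTr m n B)" "subcategory (LAlt m n B) (Alt m n B)"
    using cats unfolding UTr_def LTr_def Alt_def UAlt_def LAlt_def
    by (intro subcategory_restrict_cat_mono;
        auto simp: alternating_basis_def descending_alternating_basis_def
          ascending_alternating_basis_def)+
  with CB UTr LTr Alt UAlt LAlt show ?thesis
    unfolding full_subcategory_def by blast
qed

end
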